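(* Let $m,n\in\mathbb{N}$ be positive integers with $2m\le n$, put $t=m/n$ (so $0<t\le \tfrac12$), and let $\varphi(z)=1+z+t z^2$. If $f\in\mathcal{C}(\varphi)$ has the expansion $f(z)=z+\sum_{k=2}^{\infty}a_k z^k$ in $\mathbb{D}$, then the second Hankel determinant $H_2(2)=a_2a_4-a_3^2$ satisfies \[ |H_2(2)|=|a_2a_4-a_3^2|\le \begin{cases} \dfrac{1}{36}, & 0\le t\le \dfrac14,\\[2mm] \dfrac{1}{144}\left(4+\dfrac{(4t-1)^2}{8+20t-16t^2}\right), & \dfrac14\le t\le \dfrac12. \end{cases} \] Moreover, the estimate is sharp: for each such $m,n$ there is a function $f\in\mathcal{C}(\varphi)$ for which equality holds.
   Context: $\mathbb{D}=\{z\in\mathbb{C}:|z|<1\}$. $\mathcal{A}$ is the class of functions $f$ analytic in $\mathbb{D}$ with $f(0)=0$ and $f'(0)=1$. For analytic functions $g,h$ in $\mathbb{D}$, $g\prec h$ ($g$ is subordinate to $h$) means that there is an analytic function $w$ on $\mathbb{D}$ with $w(0)=0$ and $|w(z)|<1$ for all $z\in\mathbb{D}$ such that $g(z)=h(w(z))$ for all $z\in\mathbb{D}$. The class $\mathcal{C}(\varphi)$ is \[ \mathcal{C}(\varphi)=\left\{f\in\mathcal{A}: 1+\frac{z f''(z)}{f'(z)}\prec\varphi(z)\right\}. \] *)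

theory Defs
  imports "HOL-Complex_Analysis.Complex_Analysis"
begin

abbreviation unit_disc :: "complex set" where
  "unit_disc \<equiv> ball 0 1"

definition class_A :: "(complex \<Rightarrow> complex) set" where
  "class_A = {f. f analytic_on unit_disc \<and> f 0 = 0 \<and> deriv f 0 = 1}"

definition subordinate :: "(complex \<Rightarrow> complex) \<Rightarrow> (complex \<Rightarrow> complex) \<Rightarrow> bool"
    (infix \<open>\<prec>\<^sub>s\<close> 50) where
  "g \<prec>\<^sub>s h \<longleftrightarrow>
     g analytic_on unit_disc \<and> h analytic_on unit_disc \<and>
     (\<exists>w. w analytic_on unit_disc \<and> w 0 = 0 \<and>
          (\<forall>z\<in>unit_disc. cmod (w z) < 1) \<and>
          (\<forall>z\<in>unit_disc. g z = h (w z)))"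

text \<open>
  The condition that the derivative has no zero in the disc makes the quotient below
  meaningful in spite of the convention \<open>x / 0 = 0\<close>. It is no extra restriction: at a zero
  of \<open>f'\<close> other than the origin, \<open>z f'' / f'\<close> has a pole and cannot agree with an analytic
  function nearby.
\<close>
definition class_C :: "(complex \<Rightarrow> complex) \<Rightarrow> (complex \<Rightarrow> complex) set" where
  "class_C \<phi> = {f \<in> class_A.
     (\<forall>z\<in>unit_disc. deriv f z \<noteq> 0) \<and>
     (\<lambda>z. 1 + z * deriv (deriv f) z / deriv f z) \<prec>\<^sub>s \<phi>}"

text \<open>
  \<open>f z = z + (\<Sum>k\<ge>2. a k * z ^ k)\<close> throughout the disc; the values \<open>a 0\<close> and \<open>a 1\<close> play no role.
\<close>
definition has_expansion :: "(complex \<Rightarrow> complex) \<Rightarrow> (nat \<Rightarrow> complex) \<Rightarrow> bool" where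
  "has_expansion f a \<longleftrightarrow>
     (\<forall>z\<in>unit_disc. (\<lambda>k. a (k + 2) * z ^ (k + 2)) sums (f z - z))"

definition phi :: "real \<Rightarrow> complex \<Rightarrow> complex" where
  "phi t z = 1 + z + of_real t * z ^ 2"

end

theory Submission
  imports Defs
begin

text \<open>
  If \<open>f\<close> lies in the class, then \<open>z f'' = f' (w + t w\<^sup>2)\<close> for a Schwarz function
  \<open>w = c\<^sub>1 z + c\<^sub>2 z\<^sup>2 + c\<^sub>3 z\<^sup>3 + \<dots>\<close>, and comparing coefficients expresses the Hankel determinant
  through \<open>w\<close>:
  \<open>144 (a\<^sub>2 a\<^sub>4 - a\<^sub>3\<^sup>2) = 6 c\<^sub>1 c\<^sub>3 - 4 c\<^sub>2\<^sup>2 + (4 t + 1) c\<^sub>1\<^sup>2 c\<^sub>2 - (1 - t + 4 t\<^sup>2) c\<^sub>1\<^sup>4\<close>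
  (lemma \<open>Hankel_determinant_subordinate\<close>).

  Two steps of Schur's algorithm parametrize the coefficients of a Schwarz function by points
  \<open>x\<close>, \<open>y\<close> of the closed disc: \<open>c\<^sub>2 = (1 - |c\<^sub>1|\<^sup>2) x\<close> and
  \<open>c\<^sub>3 = (1 - |c\<^sub>1|\<^sup>2) ((1 - |x|\<^sup>2) y - cnj c\<^sub>1 x\<^sup>2)\<close> (lemma \<open>Schwarz_coefficients\<close>). After this
  substitution the triangle inequality gives a bound that increases with \<open>|x|\<close>; at \<open>|x| = 1\<close> it
  is the quadratic \<open>4 + (4 t - 1) s - (2 + 5 t - 4 t\<^sup>2) s\<^sup>2\<close> in \<open>s = |c\<^sub>1|\<^sup>2\<close>
  (lemma \<open>Hankel_modulus_le\<close>). Its maximum over \<open>s \<ge> 0\<close> sits at \<open>s = 0\<close> when \<open>t \<le> 1/4\<close> and at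
  \<open>s = (4 t - 1) / (2 (2 + 5 t - 4 t\<^sup>2))\<close> otherwise, which gives the two branches of the estimate.

  Nothing is lost in the triangle inequality when \<open>c\<^sub>1 = p\<close> is real and nonnegative and
  \<open>x = -1\<close>: then all the terms are nonpositive. The corresponding Schwarz function is
  \<open>w(z) = z (p - z) / (1 - p z)\<close>, and every Schwarz function comes from a member of the class,
  obtained by integrating the differential equation. Taking \<open>p\<^sup>2\<close> to be the maximizing \<open>s\<close>
  proves sharpness.
\<close>

(* The dollar sign is to denote only coefficients of power series, not vector components. *)
unbundle no vec_syntax

section \<open>Coefficients of Schwarz functions\<close>

lemma Schwarz_quotient:
  assumes "u holomorphic_on unit_disc" and "u 0 = 0"
    and lt: "\<And>z. cmod z < 1 \<Longrightarrow> cmod (u z) < 1"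
  obtains g where "g holomorphic_on unit_disc"
    and "\<And>z. cmod z < 1 \<Longrightarrow> cmod (g z) \<le> 1" and "\<And>z. cmod z < 1 \<Longrightarrow> u z = z * g z"
proof -
  obtain g where g: "g holomorphic_on unit_disc" "\<And>z. cmod z < 1 \<Longrightarrow> u z = z * g z"
    "deriv u 0 = g 0"
    using Schwarz3[OF assms(1,2)] by metis
  have "cmod (g z) \<le> 1" if z: "cmod z < 1" for z
  proof (cases "z = 0")
    case True
    with g(3) Schwarz_Lemma(2)[OF assms, of 0] show ?thesis by simp
  next
    case False
    have "cmod z * cmod (g z) \<le> cmod z"
      using Schwarz_Lemma(1)[OF assms z] g(2)[OF z] by (simp add: norm_mult)
    with False show ?thesis by simp
  qed
  with g that show ?thesis by blast
qed

text \<open>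
  The Moebius map that takes \<open>h 0\<close> to \<open>0\<close> turns \<open>h\<close> into a Schwarz function, whose quotient by
  \<open>z\<close> is \<open>g\<close>. Clearing the denominator keeps the relation valid for a function \<open>h\<close> that reaches
  modulus \<open>1\<close>: such a function is constant, and \<open>g = 0\<close> will do.
\<close>
lemma Schur_step:
  assumes h: "h holomorphic_on unit_disc" and le: "\<And>z. cmod z < 1 \<Longrightarrow> cmod (h z) \<le> 1"
  obtains g where "g holomorphic_on unit_disc" and "\<And>z. cmod z < 1 \<Longrightarrow> cmod (g z) \<le> 1"
    and "\<And>z. cmod z < 1 \<Longrightarrow> h z - h 0 = z * g z * (1 - cnj (h 0) * h z)"
proof (cases "\<exists>z. cmod z < 1 \<and> cmod (h z) = 1")
  case True
  then obtain z where z: "cmod z < 1" "cmod (h z) = 1" by blast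
  have "h constant_on unit_disc"
    by (rule maximum_modulus_principle[where U = unit_disc and \<xi> = z])
       (use h z le in auto)
  then have const: "h z - h 0 = z * 0 * (1 - cnj (h 0) * h z)" if "cmod z < 1" for z
    using that unfolding constant_on_def by force
  show ?thesis
    by (rule that[of "\<lambda>_. 0"]) (simp, simp, rule const)
next
  case False
  with le have lt: "cmod (h z) < 1" if "cmod z < 1" for z
    using that by (metis order_le_less)
  define u where "u = Moebius_function 0 (h 0) \<circ> h"
  have h0: "cmod (h 0) < 1" using lt by simp
  have "u holomorphic_on unit_disc"
    unfolding u_def
    by (rule holomorphic_on_compose_gen[OF h Moebius_function_holomorphic[OF h0]])
       (use lt in auto)
  moreover have "u 0 = 0" by (simp add: u_def Moebius_function_eq_zero)
  moreover have "cmod (u z) < 1" if "cmod z < 1" for z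
    using Moebius_function_norm_lt_1[OF h0 lt[OF that]] by (simp add: u_def)
  ultimately obtain g where g: "g holomorphic_on unit_disc"
    "\<And>z. cmod z < 1 \<Longrightarrow> cmod (g z) \<le> 1" "\<And>z. cmod z < 1 \<Longrightarrow> u z = z * g z"
    by (rule Schwarz_quotient) blast+
  have "h z - h 0 = z * g z * (1 - cnj (h 0) * h z)" if z: "cmod z < 1" for z
  proof -
    have "cmod (cnj (h 0) * h z) < 1"
      using norm_mult_less[OF _ lt[OF z], of "cnj (h 0)" 1] h0 by simp
    then have "1 - cnj (h 0) * h z \<noteq> 0" by (metis eq_iff_diff_eq_0 norm_one order_less_irrefl)
    with g(3)[OF z] show ?thesis
      by (auto simp: u_def Moebius_function_simple divide_simps split: if_splits)
  qed
  with g that show ?thesis by blast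
qed

lemma fps_expansion_eq_on_disc:
  assumes "f has_fps_expansion F" and "g has_fps_expansion G"
    and "\<And>z. cmod z < 1 \<Longrightarrow> f z = g z"
  shows "F = G"
proof -
  have "\<forall>\<^sub>F z in nhds 0. f z = g z"
    using eventually_nhds_in_open[of unit_disc "0::complex"] assms(3)
    by (auto elim: eventually_mono)
  with assms(1) have "g has_fps_expansion F"
    using has_fps_expansion_cong by blast
  with assms(2) show ?thesis using fps_expansion_unique_complex by blast
qed

lemma holomorphic_fps_expansion:
  assumes "f holomorphic_on unit_disc"
  shows "f has_fps_expansion fps_expansion f 0"
  using assms by (intro has_fps_expansion_fps_expansion[of unit_disc]) auto

lemma fps_expansion_nth_0: "fps_expansion f 0 $ 0 = f 0"
  by (simp add: fps_expansion_def)

text \<open>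
  Schur's algorithm applied to \<open>h(z) = w(z) / z\<close> yields \<open>g\<close> and then \<open>k\<close>, all bounded by \<open>1\<close>;
  their values at the origin are \<open>c\<^sub>1\<close>, \<open>x\<close> and \<open>y\<close>. Comparing coefficients in the two
  recursions recovers \<open>c\<^sub>2\<close> and \<open>c\<^sub>3\<close>.
\<close>
lemma Schwarz_coefficients:
  assumes w: "w holomorphic_on unit_disc" "w 0 = 0"
    and lt: "\<And>z. cmod z < 1 \<Longrightarrow> cmod (w z) < 1"
    and W: "w has_fps_expansion W"
  obtains x y where "cmod (W $ 1) \<le> 1" "cmod x \<le> 1" "cmod y \<le> 1"
    and "W $ 2 = of_real (1 - (cmod (W $ 1))\<^sup>2) * x"
    and "W $ 3 = of_real (1 - (cmod (W $ 1))\<^sup>2) *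
                   (of_real (1 - (cmod x)\<^sup>2) * y - cnj (W $ 1) * x\<^sup>2)"
proof -
  obtain h where h: "h holomorphic_on unit_disc" "\<And>z. cmod z < 1 \<Longrightarrow> cmod (h z) \<le> 1"
    "\<And>z. cmod z < 1 \<Longrightarrow> w z = z * h z"
    using Schwarz_quotient[OF w lt] by metis
  obtain g where g: "g holomorphic_on unit_disc" "\<And>z. cmod z < 1 \<Longrightarrow> cmod (g z) \<le> 1"
    "\<And>z. cmod z < 1 \<Longrightarrow> h z - h 0 = z * g z * (1 - cnj (h 0) * h z)"
    using Schur_step[OF h(1,2)] by metis
  obtain k where k: "k holomorphic_on unit_disc" "\<And>z. cmod z < 1 \<Longrightarrow> cmod (k z) \<le> 1"
    "\<And>z. cmod z < 1 \<Longrightarrow> g z - g 0 = z * k z * (1 - cnj (g 0) * g z)"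
    using Schur_step[OF g(1,2)] by metis
  define H G K where "H = fps_expansion h 0" and "G = fps_expansion g 0"
    and "K = fps_expansion k 0"
  have H: "h has_fps_expansion H" and G: "g has_fps_expansion G" and K: "k has_fps_expansion K"
    unfolding H_def G_def K_def using h(1) g(1) k(1) by (auto intro: holomorphic_fps_expansion)
  have H0: "H $ 0 = h 0" and G0: "G $ 0 = g 0" and K0: "K $ 0 = k 0"
    by (simp_all add: H_def G_def K_def fps_expansion_nth_0)
  have WH: "W = fps_X * H"
    by (rule fps_expansion_eq_on_disc[OF W _ h(3)]) (auto intro!: fps_expansion_intros H)
  have HG: "H - fps_const (h 0) = fps_X * G * (1 - fps_const (cnj (h 0)) * H)"
    by (rule fps_expansion_eq_on_disc[OF _ _ g(3)]) (auto intro!: fps_expansion_intros H G)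
  have GK: "G - fps_const (g 0) = fps_X * K * (1 - fps_const (cnj (g 0)) * G)"
    by (rule fps_expansion_eq_on_disc[OF _ _ k(3)]) (auto intro!: fps_expansion_intros G K)
  have H1: "H $ 1 = g 0 * (1 - cnj (h 0) * h 0)"
    using arg_cong[OF HG, of "\<lambda>F. F $ 1"] H0 G0 by (simp add: mult.assoc)
  have H2: "H $ 2 = G $ 1 * (1 - cnj (h 0) * h 0) - g 0 * (cnj (h 0) * H $ 1)"
    using arg_cong[OF HG, of "\<lambda>F. F $ 2"] H0 G0
    by (simp add: mult.assoc fps_mult_nth_1)
  have G1: "G $ 1 = k 0 * (1 - cnj (g 0) * g 0)"
    using arg_cong[OF GK, of "\<lambda>F. F $ 1"] G0 K0 by (simp add: mult.assoc)
  have W1: "W $ 1 = h 0" "W $ 2 = H $ 1" "W $ 3 = H $ 2"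
    using H0 by (simp_all add: WH)
  have sq: "cnj z * z = of_real ((cmod z)\<^sup>2)" for z
    by (simp only: complex_norm_square mult.commute)
  show ?thesis
  proof (rule that[of "g 0" "k 0"])
    show "W $ 3 = of_real (1 - (cmod (W $ 1))\<^sup>2) *
                   (of_real (1 - (cmod (g 0))\<^sup>2) * k 0 - cnj (W $ 1) * (g 0)\<^sup>2)"
      unfolding W1 H2 H1 G1 sq by (simp add: algebra_simps power2_eq_square)
    show "W $ 2 = of_real (1 - (cmod (W $ 1))\<^sup>2) * g 0"
      unfolding W1 H1 sq by (simp add: mult.commute)
    show "cmod (W $ 1) \<le> 1" unfolding W1 by (simp add: h(2))
  qed (simp_all add: g(2) k(2))
qed

section \<open>The Hankel determinant in terms of the Schwarz function\<close>

text \<open>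
  The hypotheses are the coefficient equations of \<open>z f'' = f' (w + t w\<^sup>2)\<close> in degrees \<open>1\<close>, \<open>2\<close>, \<open>3\<close>.
  They can be solved for \<open>c\<^sub>1\<close>, \<open>c\<^sub>2\<close>, \<open>c\<^sub>3\<close> without division, which leaves a polynomial
  identity in \<open>f\<^sub>2\<close>, \<open>f\<^sub>3\<close>, \<open>f\<^sub>4\<close> and \<open>t\<close>.
\<close>
lemma Hankel_determinant_elim:
  fixes f2 f3 f4 c1 c2 c3 t :: complex
  assumes f2: "2 * f2 = c1" and f3: "6 * f3 = c2 + t * c1\<^sup>2 + 2 * f2 * c1"
    and f4: "12 * f4 = c3 + 2 * t * c1 * c2 + 2 * f2 * (c2 + t * c1\<^sup>2) + 3 * f3 * c1"
  shows "144 * (f2 * f4 - f3\<^sup>2) =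
    6 * c1 * c3 - 4 * c2\<^sup>2 + (4 * t + 1) * c1\<^sup>2 * c2 - (1 - t + 4 * t\<^sup>2) * c1 ^ 4"
proof -
  have c1: "c1 = 2 * f2"
    using f2 by (rule sym)
  have c2: "c2 = 6 * f3 - t * c1\<^sup>2 - 2 * f2 * c1"
    unfolding f3 by algebra
  have c3: "c3 = 12 * f4 - 2 * t * c1 * c2 - 2 * f2 * (c2 + t * c1\<^sup>2) - 3 * f3 * c1"
    unfolding f4 by algebra
  show ?thesis
    unfolding c3 unfolding c2 unfolding c1 by algebra
qed

lemma Hankel_determinant_eq:
  fixes F W :: "complex fps" and t :: complex
  assumes F: "F $ 0 = 0" "F $ 1 = 1" and W0: "W $ 0 = 0"
    and ode: "fps_X * fps_deriv (fps_deriv F) = fps_deriv F * (W + fps_const t * W\<^sup>2)"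
  shows "144 * (F $ 2 * F $ 4 - (F $ 3)\<^sup>2) =
    6 * W $ 1 * W $ 3 - 4 * (W $ 2)\<^sup>2 + (4 * t + 1) * (W $ 1)\<^sup>2 * W $ 2
      - (1 - t + 4 * t\<^sup>2) * (W $ 1) ^ 4"
proof (rule Hankel_determinant_elim)
  note nth = fps_mult_nth power2_eq_square numeral_eq_Suc sum.atLeast0_atMost_Suc
  show "2 * F $ 2 = W $ 1"
    using arg_cong[OF ode, of "\<lambda>F. F $ 1"] F W0 by (simp add: nth)
  show "6 * F $ 3 = W $ 2 + t * (W $ 1)\<^sup>2 + 2 * F $ 2 * W $ 1"
    using arg_cong[OF ode, of "\<lambda>F. F $ 2"] F W0 by (simp add: nth algebra_simps)
  show "12 * F $ 4 = W $ 3 + 2 * t * W $ 1 * W $ 2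
      + 2 * F $ 2 * (W $ 2 + t * (W $ 1)\<^sup>2) + 3 * F $ 3 * W $ 1"
    using arg_cong[OF ode, of "\<lambda>F. F $ 3"] F W0 by (simp add: nth algebra_simps)
qed

lemma has_expansion_imp_fps:
  assumes "has_expansion f a"
  shows "f has_fps_expansion Abs_fps (\<lambda>k. if k = 0 then 0 else if k = 1 then 1 else a k)"
    (is "_ has_fps_expansion ?F")
proof (rule has_fps_expansionI)
  have "(\<lambda>k. ?F $ k * z ^ k) sums f z" if "z \<in> unit_disc" for z
  proof -
    have "(\<lambda>k. ?F $ (k + 2) * z ^ (k + 2)) sums (f z - (\<Sum>k<2. ?F $ k * z ^ k))"
      using assms that by (simp add: has_expansion_def numeral_2_eq_2)
    then show ?thesis by (subst (asm) sums_iff_shift) simp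
  qed
  then show "\<forall>\<^sub>F z in nhds 0. (\<lambda>k. ?F $ k * z ^ k) sums f z"
    using eventually_nhds_in_open[of unit_disc 0] by (auto elim: eventually_mono)
qed

lemma Hankel_determinant_subordinate:
  assumes f: "f \<in> class_A" "has_expansion f a"
    and w: "w holomorphic_on unit_disc" "w 0 = 0" "w has_fps_expansion W"
    and ode: "\<And>z. cmod z < 1 \<Longrightarrow>
      z * deriv (deriv f) z = deriv f z * (w z + of_real t * (w z)\<^sup>2)"
  shows "144 * (a 2 * a 4 - (a 3)\<^sup>2) =
    6 * W $ 1 * W $ 3 - 4 * (W $ 2)\<^sup>2 + (4 * of_real t + 1) * (W $ 1)\<^sup>2 * W $ 2
      - (1 - of_real t + 4 * (of_real t)\<^sup>2) * (W $ 1) ^ 4"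
proof -
  define F where "F = Abs_fps (\<lambda>k. if k = 0 then 0 else if k = 1 then 1 else a k)"
  have F: "f has_fps_expansion F"
    unfolding F_def by (rule has_expansion_imp_fps[OF f(2)])
  have "W $ 0 = 0"
    using has_fps_expansion_imp_0_eq_fps_nth_0[OF w(3)] w(2) by simp
  moreover have "fps_X * fps_deriv (fps_deriv F) = fps_deriv F * (W + fps_const (of_real t) * W\<^sup>2)"
    by (rule fps_expansion_eq_on_disc[OF _ _ ode]) (auto intro!: fps_expansion_intros F w(3))
  ultimately show ?thesis
    using Hankel_determinant_eq[of F W "of_real t"] by (simp add: F_def)
qed

section \<open>The coefficient inequality\<close>

text \<open>
  Put \<open>p = |c|\<close> and \<open>r = |x|\<close>. Since \<open>c cnj c = p\<^sup>2\<close>, the phase of \<open>c\<close> drops out of the part of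
  \<open>c c\<^sub>3\<close> that contains \<open>x\<^sup>2\<close>, and this part merges with \<open>4 c\<^sub>2\<^sup>2\<close>. The triangle inequality then
  leaves a quadratic in \<open>r\<close> whose leading coefficient is proportional to
  \<open>4 + 2 p\<^sup>2 - 6 p = 2 (1 - p) (2 - p) \<ge> 0\<close>, so that its maximum over \<open>[0, 1]\<close> is at \<open>r = 1\<close>.
\<close>
lemma Hankel_modulus_le:
  fixes c x y :: complex and t :: real
  assumes t: "0 \<le> t" and le: "cmod c \<le> 1" "cmod x \<le> 1" "cmod y \<le> 1"
    and c2: "c2 = of_real (1 - (cmod c)\<^sup>2) * x"
    and c3: "c3 = of_real (1 - (cmod c)\<^sup>2) * (of_real (1 - (cmod x)\<^sup>2) * y - cnj c * x\<^sup>2)"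
  shows "cmod (6 * c * c3 - 4 * c2\<^sup>2 + (4 * of_real t + 1) * c\<^sup>2 * c2
      - (1 - of_real t + 4 * (of_real t)\<^sup>2) * c ^ 4)
    \<le> 4 + (4 * t - 1) * (cmod c)\<^sup>2 - (2 + 5 * t - 4 * t\<^sup>2) * (cmod c) ^ 4"
proof -
  define p r q where "p = cmod c" and "r = cmod x" and "q = 1 - t + 4 * t\<^sup>2"
  have p: "0 \<le> p" "p \<le> 1" and r: "0 \<le> r" "r \<le> 1" using le by (auto simp: p_def r_def)
  have p2: "p\<^sup>2 \<le> 1" and r2: "r\<^sup>2 \<le> 1" using p r by (simp_all add: power_le_one)
  have q: "0 \<le> q"
    using zero_le_power2[of "t - 1/8"] by (simp add: q_def power2_eq_square field_simps)
  have ccnj: "c * cnj c = of_real (p\<^sup>2)" unfolding p_def by (simp only: complex_norm_square)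
  define A B C D where "A = of_real (6 * (1 - p\<^sup>2) * (1 - r\<^sup>2)) * c * y"
    and "B = of_real ((1 - p\<^sup>2) * (4 + 2 * p\<^sup>2)) * x\<^sup>2"
    and "C = of_real ((1 - p\<^sup>2) * (4 * t + 1)) * c\<^sup>2 * x"
    and "D = of_real q * c ^ 4"
  define G where "G = of_real (6 * (1 - p\<^sup>2) * p\<^sup>2) * x\<^sup>2"
  have AG: "6 * c * c3 = A - G"
  proof -
    have "6 * c * c3 = A - 6 * of_real (1 - p\<^sup>2) * (c * cnj c) * x\<^sup>2"
      unfolding c3 A_def p_def r_def by (simp add: algebra_simps)
    then show ?thesis unfolding ccnj G_def by (simp add: mult.assoc)
  qed
  have Dq: "(1 - of_real t + 4 * (of_real t)\<^sup>2) * c ^ 4 = D"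
    by (simp add: D_def q_def)
  have Cc: "(4 * of_real t + 1) * c\<^sup>2 * c2 = C"
    by (simp add: C_def c2 p_def algebra_simps)
  have BG: "B = G + 4 * c2\<^sup>2"
    unfolding c2 B_def G_def p_def[symmetric] by (simp add: algebra_simps power2_eq_square)
  have "6 * c * c3 - 4 * c2\<^sup>2 + (4 * of_real t + 1) * c\<^sup>2 * c2
      - (1 - of_real t + 4 * (of_real t)\<^sup>2) * c ^ 4 = A - B + C - D"
    unfolding AG Dq Cc BG by simp
  then have "cmod (6 * c * c3 - 4 * c2\<^sup>2 + (4 * of_real t + 1) * c\<^sup>2 * c2
      - (1 - of_real t + 4 * (of_real t)\<^sup>2) * c ^ 4) = cmod (A - B + C - D)"
    by (rule arg_cong)
  also have "\<dots> \<le> cmod A + cmod B + cmod C + cmod D"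
    by (smt (verit) norm_triangle_ineq norm_triangle_ineq4)
  also have "cmod A = 6 * (1 - p\<^sup>2) * (1 - r\<^sup>2) * p * cmod y"
    using p2 r2 by (simp only: A_def norm_mult norm_of_real p_def) simp
  also have "cmod B = (1 - p\<^sup>2) * (4 + 2 * p\<^sup>2) * r\<^sup>2"
    using p2 by (simp only: B_def norm_mult norm_of_real norm_power r_def) simp
  also have "cmod C = (1 - p\<^sup>2) * (4 * t + 1) * p\<^sup>2 * r"
    using p2 t by (simp only: C_def norm_mult norm_of_real norm_power r_def p_def) simp
  also have "cmod D = q * p ^ 4"
    using q by (simp add: D_def norm_mult norm_power p_def)
  also have "6 * (1 - p\<^sup>2) * (1 - r\<^sup>2) * p * cmod y \<le> (1 - p\<^sup>2) * (6 * p * (1 - r\<^sup>2))"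
  proof -
    have "0 \<le> 6 * (1 - p\<^sup>2) * (1 - r\<^sup>2) * p" using p p2 r2 by simp
    from mult_left_mono[OF le(3) this] show ?thesis by (simp only: mult_ac mult_1_right)
  qed
  also have "(1 - p\<^sup>2) * (6 * p * (1 - r\<^sup>2)) + (1 - p\<^sup>2) * (4 + 2 * p\<^sup>2) * r\<^sup>2
      + (1 - p\<^sup>2) * (4 * t + 1) * p\<^sup>2 * r + q * p ^ 4
    = (1 - p\<^sup>2) * (6 * p + 2 * (1 - p) * (2 - p) * r\<^sup>2 + (4 * t + 1) * p\<^sup>2 * r) + q * p ^ 4"
    by (simp add: algebra_simps power2_eq_square)
  also have "\<dots> \<le> (1 - p\<^sup>2) * (6 * p + 2 * (1 - p) * (2 - p) * 1 + (4 * t + 1) * p\<^sup>2 * 1) + q * p ^ 4"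
    using p p2 r r2 t by (intro add_mono mult_left_mono order_refl) auto
  also have "\<dots> = 4 + (4 * t - 1) * p\<^sup>2 - (2 + 5 * t - 4 * t\<^sup>2) * p ^ 4"
    by (simp add: q_def algebra_simps power2_eq_square power4_eq_xxxx)
  finally show ?thesis by (simp add: p_def)
qed

section \<open>The class and its Schwarz functions\<close>

lemma class_C_phi_obtain_ode:
  assumes "f \<in> class_C (phi t)"
  obtains w where "w holomorphic_on unit_disc" "w 0 = 0" "\<And>z. cmod z < 1 \<Longrightarrow> cmod (w z) < 1"
    "\<And>z. cmod z < 1 \<Longrightarrow> z * deriv (deriv f) z = deriv f z * (w z + of_real t * (w z)\<^sup>2)"
proof -
  obtain w where w: "w analytic_on unit_disc" "w 0 = 0" "\<forall>z\<in>unit_disc. cmod (w z) < 1"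
    and eq: "\<forall>z\<in>unit_disc. 1 + z * deriv (deriv f) z / deriv f z = phi t (w z)"
    and nz: "\<forall>z\<in>unit_disc. deriv f z \<noteq> 0"
    using assms by (auto simp: class_C_def subordinate_def)
  show ?thesis
  proof (rule that[of w])
    show "w holomorphic_on unit_disc" by (rule analytic_imp_holomorphic[OF w(1)])
    fix z :: complex assume z: "cmod z < 1"
    show "z * deriv (deriv f) z = deriv f z * (w z + of_real t * (w z)\<^sup>2)"
      using eq[rule_format, of z] nz[rule_format, of z] z by (simp add: phi_def field_simps)
  qed (use w in auto)
qed

text \<open>
  With \<open>w(z) = z h(z)\<close>, the equation \<open>f'' / f' = (w + t w\<^sup>2) / z\<close> has the holomorphic right-hand side
  \<open>q = h + t z h\<^sup>2\<close>, so \<open>f' = exp (\<integral> q)\<close> is a zero-free solution, and \<open>f\<close> is its primitive.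
\<close>
lemma class_C_phi_exists:
  assumes w: "w holomorphic_on unit_disc" "w 0 = 0" "\<And>z. cmod z < 1 \<Longrightarrow> cmod (w z) < 1"
  obtains f a where "f \<in> class_C (phi t)" "has_expansion f a"
    "\<And>z. cmod z < 1 \<Longrightarrow> z * deriv (deriv f) z = deriv f z * (w z + of_real t * (w z)\<^sup>2)"
proof -
  obtain h where h: "h holomorphic_on unit_disc" "\<And>z. cmod z < 1 \<Longrightarrow> w z = z * h z"
    using Schwarz3[OF w(1,2)] by metis
  define q where "q z = h z + of_real t * z * (h z)\<^sup>2" for z
  have q: "q holomorphic_on unit_disc"
    unfolding q_def by (intro holomorphic_intros h)
  obtain Q where Q: "\<And>z. z \<in> unit_disc \<Longrightarrow> (Q has_field_derivative q z) (at z)"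
    using holomorphic_convex_primitive'[OF _ _ q] by (metis at_within_open convex_ball open_ball)
  define e where "e z = exp (Q z - Q 0)" for z
  have e: "(e has_field_derivative e z * q z) (at z)" if "z \<in> unit_disc" for z
    unfolding e_def by (rule derivative_eq_intros Q that refl | simp)+
  then have "e holomorphic_on unit_disc" by (meson holomorphic_on_open open_ball)
  then obtain f0 where f0: "\<And>z. z \<in> unit_disc \<Longrightarrow> (f0 has_field_derivative e z) (at z)"
    using holomorphic_convex_primitive'[of unit_disc e] by (metis at_within_open convex_ball open_ball)
  define f where "f z = f0 z - f0 0" for z
  have f: "(f has_field_derivative e z) (at z)" if "z \<in> unit_disc" for z
    unfolding f_def by (rule derivative_eq_intros f0 that refl | simp)+
  then have hol: "f holomorphic_on unit_disc" by (meson holomorphic_on_open open_ball)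
  have df: "deriv f z = e z" if "z \<in> unit_disc" for z
    by (rule DERIV_imp_deriv[OF f[OF that]])
  have ddf: "deriv (deriv f) z = e z * q z" if z: "z \<in> unit_disc" for z
  proof (rule DERIV_imp_deriv)
    show "(deriv f has_field_derivative e z * q z) (at z)"
      by (rule has_field_derivative_transform_within_open[OF e[OF z] open_ball z]) (simp add: df)
  qed
  have zq: "z * q z = w z + of_real t * (w z)\<^sup>2" if "z \<in> unit_disc" for z
    using that by (simp add: q_def h(2) algebra_simps power2_eq_square)
  have nz: "deriv f z \<noteq> 0" if "z \<in> unit_disc" for z
    using df[OF that] by (simp add: e_def)
  have A: "f \<in> class_A"
    using hol df[of 0] by (simp add: class_A_def analytic_on_open f_def e_def)
  have eq: "1 + z * deriv (deriv f) z / deriv f z = phi t (w z)" if "z \<in> unit_disc" for z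
    using zq[OF that] nz[OF that] by (simp add: ddf[OF that] df[OF that] phi_def)
  have ana: "phi t analytic_on unit_disc"
    unfolding phi_def by (intro analytic_intros)
  have "(\<lambda>z. 1 + z * deriv (deriv f) z / deriv f z) analytic_on unit_disc"
    using hol nz by (auto simp: analytic_on_open intro!: holomorphic_intros)
  with ana eq w have "(\<lambda>z. 1 + z * deriv (deriv f) z / deriv f z) \<prec>\<^sub>s phi t"
    unfolding subordinate_def by (intro conjI exI[of _ w]) (auto simp: analytic_on_open)
  with A nz have "f \<in> class_C (phi t)" by (simp add: class_C_def)
  moreover have "has_expansion f (\<lambda>k. (deriv ^^ k) f 0 / fact k)"
    unfolding has_expansion_def
  proof
    fix z :: complex assume z: "z \<in> unit_disc"
    have "(\<lambda>k. (deriv ^^ k) f 0 / fact k * z ^ k) sums f z"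
      using holomorphic_power_series[OF hol z] by simp
    then have "(\<lambda>k. (deriv ^^ (k + 2)) f 0 / fact (k + 2) * z ^ (k + 2)) sums
        (f z - (\<Sum>k<2. (deriv ^^ k) f 0 / fact k * z ^ k))"
      by (subst sums_iff_shift) simp
    moreover have "(\<Sum>k<2. (deriv ^^ k) f 0 / fact k * z ^ k) = z"
      using A by (simp add: numeral_2_eq_2 class_A_def)
    ultimately show "(\<lambda>k. (deriv ^^ (k + 2)) f 0 / fact (k + 2) * z ^ (k + 2)) sums (f z - z)"
      by simp
  qed
  moreover have "z * deriv (deriv f) z = deriv f z * (w z + of_real t * (w z)\<^sup>2)"
    if "cmod z < 1" for z
    using zq[of z] ddf[of z] df[of z] that by (simp add: mult.left_commute)
  ultimately show ?thesis using that by blast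
qed

text \<open>
  The Schwarz function \<open>w(z) = z (p - z) / (1 - p z)\<close> has the parameters \<open>c\<^sub>1 = p\<close> and \<open>x = -1\<close>,
  hence \<open>c\<^sub>2 = p\<^sup>2 - 1\<close> and \<open>c\<^sub>3 = p (p\<^sup>2 - 1)\<close>. For these all terms of the Hankel determinant
  have the same sign, so equality holds in \<open>Hankel_modulus_le\<close>.
\<close>
lemma class_C_phi_attains:
  fixes t p :: real
  assumes t: "0 \<le> t" "t \<le> 1 / 2" and p: "0 \<le> p" "p < 1"
  obtains f a where "f \<in> class_C (phi t)" "has_expansion f a"
    "144 * cmod (a 2 * a 4 - (a 3)\<^sup>2) = 4 + (4 * t - 1) * p\<^sup>2 - (2 + 5 * t - 4 * t\<^sup>2) * p ^ 4"
proof -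
  define w where "w z = z * - Moebius_function 0 (of_real p) z" for z
  have np: "cmod (of_real p) < 1" using p by simp
  have w: "w holomorphic_on unit_disc"
    unfolding w_def by (intro holomorphic_intros Moebius_function_holomorphic np)
  have w0: "w 0 = 0" by (simp add: w_def)
  have lt: "cmod (w z) < 1" if "cmod z < 1" for z
  proof -
    have "cmod (z * - Moebius_function 0 (of_real p) z) < 1 * 1"
      using Moebius_function_norm_lt_1[OF np that] that by (intro norm_mult_less) simp_all
    then show ?thesis by (simp add: w_def)
  qed
  define W where "W = fps_expansion w 0"
  have W: "w has_fps_expansion W" unfolding W_def by (rule holomorphic_fps_expansion[OF w])
  have weq: "w z * (1 - of_real p * z) = z * (of_real p - z)" if "cmod z < 1" for z
  proof -
    have "cmod (of_real p * z) < 1" using norm_mult_less[OF np that] by simp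
    then have "1 - of_real p * z \<noteq> 0" by (metis eq_iff_diff_eq_0 norm_one order_less_irrefl)
    then show ?thesis by (simp add: w_def Moebius_function_simple) (simp add: algebra_simps)
  qed
  have WP: "W * (1 - fps_const (of_real p) * fps_X) = fps_X * (fps_const (of_real p) - fps_X)"
    by (rule fps_expansion_eq_on_disc[OF _ _ weq]) (auto intro!: fps_expansion_intros W)
  note nth = fps_mult_nth numeral_eq_Suc sum.atLeast0_atMost_Suc
  have W0: "W $ 0 = 0" using arg_cong[OF WP, of "\<lambda>F. F $ 0"] by simp
  have W1: "W $ 1 = of_real p"
    using arg_cong[OF WP, of "\<lambda>F. F $ 1"] W0 by (simp add: nth)
  have W2: "W $ 2 = of_real (p\<^sup>2 - 1)"
    using arg_cong[OF WP, of "\<lambda>F. F $ 2"] W0 W1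
    by (simp add: nth algebra_simps)
  have "W $ 3 = of_real p * W $ 2"
    using arg_cong[OF WP, of "\<lambda>F. F $ 3"] W0 by (simp add: nth)
  then have W3: "W $ 3 = of_real (p * (p\<^sup>2 - 1))"
    by (simp add: W2)
  obtain f a where f: "f \<in> class_C (phi t)" "has_expansion f a"
    "\<And>z. cmod z < 1 \<Longrightarrow> z * deriv (deriv f) z = deriv f z * (w z + of_real t * (w z)\<^sup>2)"
    using class_C_phi_exists[OF w w0 lt] by metis
  define M where "M = 4 + (4 * t - 1) * p\<^sup>2 - (2 + 5 * t - 4 * t\<^sup>2) * p ^ 4"
  have fA: "f \<in> class_A" using f(1) by (simp add: class_C_def)
  have "144 * (a 2 * a 4 - (a 3)\<^sup>2) =
      6 * W $ 1 * W $ 3 - 4 * (W $ 2)\<^sup>2 + (4 * of_real t + 1) * (W $ 1)\<^sup>2 * W $ 2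
        - (1 - of_real t + 4 * (of_real t)\<^sup>2) * (W $ 1) ^ 4"
    by (rule Hankel_determinant_subordinate[OF fA f(2) w w0 W f(3)])
  also have "\<dots> = of_real (- M)"
    unfolding W1 W2 W3 M_def by (simp add: algebra_simps power2_eq_square power4_eq_xxxx)
  finally have "cmod (144 * (a 2 * a 4 - (a 3)\<^sup>2)) = cmod (of_real (- M))" by (rule arg_cong)
  then have "144 * cmod (a 2 * a 4 - (a 3)\<^sup>2) = \<bar>M\<bar>"
    by (simp only: norm_mult norm_of_real norm_numeral abs_minus_cancel)
  moreover have "M \<ge> 0"
  proof -
    have "M = (1 - p\<^sup>2) * (4 + 2 * p\<^sup>2 + (4 * t + 1) * p\<^sup>2) + (1 - t + 4 * t\<^sup>2) * p ^ 4"
      by (simp add: M_def algebra_simps power2_eq_square power4_eq_xxxx)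
    moreover have "p\<^sup>2 \<le> 1" using p by (simp add: power_le_one)
    ultimately show ?thesis using t by simp
  qed
  ultimately show ?thesis using that[OF f(1,2)] by (simp add: M_def)
qed

section \<open>The sharp estimate\<close>

theorem theorem3p1:
  fixes m n :: nat and t :: real
  assumes "m > 0" and "n > 0" and "2 * m \<le> n"
    and "t = real m / real n"
  defines "B \<equiv> (if t \<le> 1 / 4 then 1 / 36
                else 1 / 144 * (4 + (4 * t - 1) ^ 2 / (8 + 20 * t - 16 * t ^ 2)))"
  shows "(\<forall>f a. f \<in> class_C (phi t) \<and> has_expansion f a \<longrightarrow>
            cmod (a 2 * a 4 - (a 3) ^ 2) \<le> B) \<and>
         (\<exists>f a. f \<in> class_C (phi t) \<and> has_expansion f a \<and>
            cmod (a 2 * a 4 - (a 3) ^ 2) = B)"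
proof -
  have t0: "0 \<le> t" using assms by simp
  have "2 * real m \<le> real n" using assms(3) by linarith
  then have t1: "t \<le> 1 / 2"
    unfolding assms(4) using assms(2) by (subst pos_divide_le_eq) simp_all
  define D where "D = 2 + 5 * t - 4 * t\<^sup>2"
  have "t\<^sup>2 \<le> t * (1 / 2)" unfolding power2_eq_square using t0 t1 by (intro mult_left_mono) auto
  with t0 have D: "2 + 3 * t \<le> D" by (simp add: D_def)
  with t0 have D0: "0 < D" by linarith
  have B: "144 * B = (if t \<le> 1 / 4 then 4 else 4 + (4 * t - 1)\<^sup>2 / (4 * D))"
  proof -
    have "8 + 20 * t - 16 * t\<^sup>2 = 4 * D" by (simp add: D_def)
    then show ?thesis by (simp add: B_def)
  qed
  (* The right-hand side is the maximum over s \<ge> 0 of this concave quadratic. *)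
  have max: "4 + (4 * t - 1) * s - D * s\<^sup>2 \<le> 144 * B" if s: "0 \<le> s" for s
  proof (cases "t \<le> 1 / 4")
    case True
    then have "(4 * t - 1) * s \<le> 0" using s by (intro mult_nonpos_nonneg) auto
    moreover have "0 \<le> D * s\<^sup>2" using D0 by simp
    ultimately show ?thesis using True B by simp
  next
    case False
    have "0 \<le> (2 * D * s - (4 * t - 1))\<^sup>2 / (4 * D)" using D0 by simp
    also have "\<dots> = (4 * t - 1)\<^sup>2 / (4 * D) - (4 * t - 1) * s + D * s\<^sup>2"
      using D0 by (simp add: field_simps power2_eq_square)
    finally show ?thesis using False B by simp
  qed
  have le: "cmod (a 2 * a 4 - (a 3)\<^sup>2) \<le> B"
    if f: "f \<in> class_C (phi t)" "has_expansion f a" for f a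
  proof -
    obtain w where w: "w holomorphic_on unit_disc" "w 0 = 0"
      "\<And>z. cmod z < 1 \<Longrightarrow> cmod (w z) < 1"
      "\<And>z. cmod z < 1 \<Longrightarrow> z * deriv (deriv f) z = deriv f z * (w z + of_real t * (w z)\<^sup>2)"
      using class_C_phi_obtain_ode[OF f(1)] by metis
    have fA: "f \<in> class_A" using f(1) by (simp add: class_C_def)
    define W where "W = fps_expansion w 0"
    have W: "w has_fps_expansion W" unfolding W_def by (rule holomorphic_fps_expansion[OF w(1)])
    obtain x y where xy: "cmod (W $ 1) \<le> 1" "cmod x \<le> 1" "cmod y \<le> 1"
      "W $ 2 = of_real (1 - (cmod (W $ 1))\<^sup>2) * x"
      "W $ 3 = of_real (1 - (cmod (W $ 1))\<^sup>2) *
                 (of_real (1 - (cmod x)\<^sup>2) * y - cnj (W $ 1) * x\<^sup>2)"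
      using Schwarz_coefficients[OF w(1-3) W] by metis
    have "144 * cmod (a 2 * a 4 - (a 3)\<^sup>2) = cmod (144 * (a 2 * a 4 - (a 3)\<^sup>2))"
      by (simp only: norm_mult norm_numeral)
    also have "\<dots> = cmod (6 * W $ 1 * W $ 3 - 4 * (W $ 2)\<^sup>2
        + (4 * of_real t + 1) * (W $ 1)\<^sup>2 * W $ 2
        - (1 - of_real t + 4 * (of_real t)\<^sup>2) * (W $ 1) ^ 4)"
      by (rule arg_cong[OF Hankel_determinant_subordinate[OF fA f(2) w(1,2) W w(4)]])
    also have "\<dots> \<le> 4 + (4 * t - 1) * (cmod (W $ 1))\<^sup>2 - D * ((cmod (W $ 1))\<^sup>2)\<^sup>2"
      using Hankel_modulus_le[OF t0 xy] by (simp add: D_def)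
    also have "\<dots> \<le> 144 * B" by (rule max) simp
    finally show ?thesis by simp
  qed
  (* The point where the quadratic attains its maximum, to be used as the square of c1. *)
  define s where "s = (if t \<le> 1 / 4 then 0 else (4 * t - 1) / (2 * D))"
  have s0: "0 \<le> s" using D0 by (simp add: s_def)
  have s1: "s < 1" using D t0 t1 D0 by (simp add: s_def)
  have s: "4 + (4 * t - 1) * s - D * s\<^sup>2 = 144 * B"
  proof (cases "t \<le> 1 / 4")
    case False
    have "b * (b / (2 * D)) - D * (b / (2 * D))\<^sup>2 = b\<^sup>2 / (4 * D)" for b
      using D0 by (simp add: field_simps power2_eq_square)
    from this[of "4 * t - 1"] False show ?thesis unfolding B s_def by simp
  qed (simp add: B s_def)
  obtain f a where "f \<in> class_C (phi t)" "has_expansion f a"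
    "144 * cmod (a 2 * a 4 - (a 3)\<^sup>2)
       = 4 + (4 * t - 1) * (sqrt s)\<^sup>2 - (2 + 5 * t - 4 * t\<^sup>2) * (sqrt s) ^ 4"
    using class_C_phi_attains[OF t0 t1, of "sqrt s"] s0 s1 by (metis real_sqrt_ge_zero real_sqrt_lt_1_iff)
  moreover have "(sqrt s) ^ 4 = s\<^sup>2"
    using s0 by (metis num_double numeral_times_numeral power_mult real_sqrt_pow2)
  ultimately have "\<exists>f a. f \<in> class_C (phi t) \<and> has_expansion f a \<and>
      cmod (a 2 * a 4 - (a 3)\<^sup>2) = B"
    using s s0 by (intro exI[of _ f] exI[of _ a]) (simp add: D_def)
  with le show ?thesis by blast
qed

end
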